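(* Let $H$ be a complex Hilbert space and let $T:H\to H$ be a nonexpansive (not necessarily linear) map. The following are equivalent: (a) There exist $\lambda\in(0,1)$ and $n_1\in\mathbb{N}$ such that $\|T^{n_1}x-T^{n_1}y\|\le\lambda\|x-y\|$ for all $x,y\in H$. (b) There exist $N\in\mathbb{N}$ and $\lambda\in(0,1)$ such that $T^N$ is $\lambda$-contractive on $H$, i.e. $\mathrm{Lip}(T^N)\le\lambda$. Moreover, if these hold, with $N$ and $\lambda$ as in (b), then $\mathrm{Lip}(T^p)\le\lambda$ for every $p\ge N$.
   Context: For a map $T:H\to H$, $\mathrm{Lip}(T):=\sup_{x\ne y}\|Tx-Ty\|/\|x-y\|\in[0,\infty]$. $T$ is nonexpansive if $\mathrm{Lip}(T)\le 1$, and $\lambda$-contractive if $\mathrm{Lip}(T)\le\lambda<1$. $T^n$ denotes the $n$-fold composition of $T$ with itself. Condition (a) is what is called an event-indexed $\lambda$-contraction. *)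

theory Defs
  imports "HOL-Analysis.Analysis"
begin

(* The superclass real_normed_vector supplies the real structure and the metric topology;
   scaleR_scaleC and norm_eq_sqrt_cinner force both to be the ones induced by the complex
   scalar multiplication and the inner product. The inner product is linear in its first
   argument. *)
class complex_inner = real_normed_vector +
  fixes scaleC :: "complex \<Rightarrow> 'a \<Rightarrow> 'a" (infixr "*\<^sub>C" 75)
    and cinner :: "'a \<Rightarrow> 'a \<Rightarrow> complex"
  assumes scaleC_add_right: "c *\<^sub>C (x + y) = c *\<^sub>C x + c *\<^sub>C y"
    and scaleC_add_left: "(c + d) *\<^sub>C x = c *\<^sub>C x + d *\<^sub>C x"
    and scaleC_scaleC: "c *\<^sub>C (d *\<^sub>C x) = (c * d) *\<^sub>C x"
    and scaleC_one: "1 *\<^sub>C x = x"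
    and scaleR_scaleC: "r *\<^sub>R x = complex_of_real r *\<^sub>C x"
    and cinner_commute: "cinner x y = cnj (cinner y x)"
    and cinner_add_left: "cinner (x + y) z = cinner x z + cinner y z"
    and cinner_scaleC_left: "cinner (c *\<^sub>C x) y = c * cinner x y"
    and cinner_ge_zero: "0 \<le> Re (cinner x x)"
    and cinner_eq_zero_iff: "cinner x x = 0 \<longleftrightarrow> x = 0"
    and norm_eq_sqrt_cinner: "norm x = sqrt (Re (cinner x x))"

class complex_hilbert_space = complex_inner + complete_space

(* On a one-point space the supremum is over the empty set and equals 0 in ennreal. *)
definition Lip :: "('a::real_normed_vector \<Rightarrow> 'a) \<Rightarrow> ennreal" where
  "Lip T = (SUP (x, y) \<in> {(x, y). x \<noteq> y}. ennreal (norm (T x - T y) / norm (x - y)))"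

definition nonexpansive :: "('a::real_normed_vector \<Rightarrow> 'a) \<Rightarrow> bool" where
  "nonexpansive T \<longleftrightarrow> Lip T \<le> 1"

(* Since ennreal sends negative reals to 0, the condition 0 \<le> l has to be stated. *)
definition contractive :: "real \<Rightarrow> ('a::real_normed_vector \<Rightarrow> 'a) \<Rightarrow> bool" where
  "contractive l T \<longleftrightarrow> 0 \<le> l \<and> Lip T \<le> ennreal l \<and> l < 1"

end

theory Submission imports Defs begin

text \<open>
  Both conditions say the same thing about a single iterate: a bound on the supremum of the
  difference quotients is a Lipschitz estimate for all pairs of points, the pairs \<open>x = y\<close> that
  the supremum leaves out being trivial (\<open>Lip_le_iff\<close>). The equivalence therefore holds with
  the same exponent and the same constant on both sides. For the last claim, an iterate beyond
  the contractive one factors as \<open>T ^^ p = T ^^ (p - N) \<circ> T ^^ N\<close>, and the outer factor does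
  not increase distances because nonexpansive maps are closed under composition.
\<close>

text \<open>
  The sign condition is essential: on a nonzero space a negative \<open>l\<close> fails the
  Lipschitz estimate, while \<open>ennreal l = 0\<close> still bounds \<open>Lip T\<close> for constant \<open>T\<close>.
\<close>
lemma Lip_le_iff:
  fixes T :: "'a::real_normed_vector \<Rightarrow> 'a"
  assumes "0 \<le> l"
  shows "Lip T \<le> ennreal l \<longleftrightarrow> (\<forall>x y. norm (T x - T y) \<le> l * norm (x - y))"
proof -
  have "Lip T \<le> ennreal l
      \<longleftrightarrow> (\<forall>x y. x \<noteq> y \<longrightarrow> norm (T x - T y) / norm (x - y) \<le> l)"
    using assms by (auto simp: Lip_def SUP_le_iff ennreal_le_iff)
  also have "\<dots> \<longleftrightarrow> (\<forall>x y. x \<noteq> y \<longrightarrow> norm (T x - T y) \<le> l * norm (x - y))"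
    by (simp add: pos_divide_le_eq)
  also have "\<dots> \<longleftrightarrow> (\<forall>x y. norm (T x - T y) \<le> l * norm (x - y))"
    by (metis diff_self norm_zero mult_zero_right order_refl)
  finally show ?thesis .
qed

lemma nonexpansive_iff:
  "nonexpansive T \<longleftrightarrow> (\<forall>x y. norm (T x - T y) \<le> norm (x - y))"
  using Lip_le_iff[of 1 T] by (simp add: nonexpansive_def)

lemma nonexpansive_funpow:
  assumes "nonexpansive T"
  shows "nonexpansive (T ^^ n)"
proof (induction n)
  case 0
  then show ?case by (simp add: nonexpansive_iff)
next
  case (Suc n)
  then show ?case
    using assms unfolding nonexpansive_iff by simp (meson order_trans)
qed

lemma Lip_nonexpansive_comp_le:
  assumes "nonexpansive S"
  shows "Lip (S \<circ> T) \<le> Lip T"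
  unfolding Lip_def
  using assms
  by (auto simp: nonexpansive_iff intro!: SUP_mono' ennreal_leI divide_right_mono)

text \<open>Iterating a nonexpansive map further can only lower the Lipschitz constant.\<close>
lemma Lip_funpow_antimono:
  assumes "nonexpansive T" and "N \<le> p"
  shows "Lip (T ^^ p) \<le> Lip (T ^^ N)"
proof -
  have "T ^^ p = T ^^ (p - N) \<circ> T ^^ N"
    using assms(2) by (simp flip: funpow_add)
  then show ?thesis
    using Lip_nonexpansive_comp_le[OF nonexpansive_funpow[OF assms(1)]] by simp
qed

theorem proposition3:
  fixes T :: "'a::complex_hilbert_space \<Rightarrow> 'a"
  assumes "nonexpansive T"
  shows "((\<exists>l::real. \<exists>n\<^sub>1::nat. 0 < l \<and> l < 1 \<and>
            (\<forall>x y. norm ((T ^^ n\<^sub>1) x - (T ^^ n\<^sub>1) y) \<le> l * norm (x - y)))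
          \<longleftrightarrow> (\<exists>N::nat. \<exists>l::real. 0 < l \<and> l < 1 \<and> contractive l (T ^^ N)))
       \<and> (\<forall>(N::nat) (l::real). 0 < l \<and> l < 1 \<and> contractive l (T ^^ N)
            \<longrightarrow> (\<forall>p\<ge>N. Lip (T ^^ p) \<le> ennreal l))"
proof -
  have contractive_iff: "contractive l (T ^^ n)
      \<longleftrightarrow> (\<forall>x y. norm ((T ^^ n) x - (T ^^ n) y) \<le> l * norm (x - y))"
    if "0 < l" "l < 1" for l n
    using that Lip_le_iff[of l "T ^^ n"] by (simp add: contractive_def)
  have "Lip (T ^^ p) \<le> ennreal l" if "contractive l (T ^^ N)" "N \<le> p" for l N p
    using Lip_funpow_antimono[OF assms that(2)] that(1)
    by (auto simp: contractive_def intro: order_trans)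
  then show ?thesis
    using contractive_iff by blast
qed

end
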